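(* Assume (FWW) for a flow $\Phi_t$ on $\mathbb{R}^n$ and a $k$-cone $C$. Let $\mathcal{D}\subset\mathbb{R}^n$ be open and $\omega$-compact, let $x\in\mathcal{D}$, and consider the $k$-exponential separation of $(\Phi_t,D\Phi_t)$ along $\omega(x)$ associated with $C$. Assume there exists a regular point $z\in\omega(x)$ with $\lambda_{kz}\le0$. Then either $x\in Q$, or $\omega(x)=\{z\}$.
   Context: A closed set $C\subset\mathbb{R}^n$ is a $k$-cone if $lv\in C$ for all $v\in C$, $l\in\mathbb{R}$, and the maximal dimension of a linear subspace contained in $C$ is $k$. $C$ is $k$-solid if there is a $k$-dimensional subspace $W$ with $W\setminus\{0\}\subset\operatorname{Int}C$. Write $x\sim y$ if $x-y\in C$ and $x\approx y$ if $x-y\in\operatorname{Int}C$. A flow $\Phi_t$ is strongly monotone with respect to a $k$-solid cone $C$ if $x\sim y$ implies $\Phi_t(x)\sim\Phi_t(y)$ for $t\ge0$, and $x\ne y$, $x\sim y$ imply $\Phi_t(x)\approx\Phi_t(y)$ for $t>0$. Assumption (FWW): the flow $\Phi_t$ on $\mathbb{R}^n$ is $C^{1,\alpha}$-smooth ($C^1$ with locally $\alpha$-Hölder derivative, $\alpha\in(0,1]$), strongly monotone with respect to the $k$-cone $C$, and $D_x\Phi_t(C\setminus\{0\})\subset\operatorname{Int}C$ for $t>0$. A set $\mathcal{D}$ is $\omega$-compact if every forward orbit $O(x)=\{\Phi_t(x):t\ge0\}$, $x\in\mathcal{D}$, is bounded and $\bigcup_{x\in\mathcal{D}}\omega(x)$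 is bounded. A nontrivial orbit $O(x)$ is pseudo-ordered if it contains two distinct points $\Phi_{t_1}(x)\sim\Phi_{t_2}(x)$; $Q$ is the set of $x$ whose orbit is pseudo-ordered. A $k$-exponential separation along a compact invariant set $K$ associated with $C$ consists of continuous (in the Grassmannian gap metric) families of $k$-dimensional subspaces $E_y$ and $(n-k)$-dimensional subspaces $F_y$, $y\in K$, with $\mathbb{R}^n=E_y\oplus F_y$, $D_y\Phi_tE_y=E_{\Phi_t(y)}$, $D_y\Phi_tF_y\subset F_{\Phi_t(y)}$ ($t>0$), constants $M>0$, $0<\gamma<1$ with $\|D_y\Phi_tw\|\le M\gamma^t\|D_y\Phi_tv\|$ for unit $w\in F_y$, $v\in E_y$, $t\ge0$, and $E_y\subset\operatorname{Int}C\cup\{0\}$, $F_y\cap C=\{0\}$; under (FWW) such a separation exists along every compact invariant set. The $k$-Lyapunov exponent is $\lambda_{kz}=\limsup_{t\to+\infty}t^{-1}\log\inf_{v\in E_z,\|v\|=1}\|D_z\Phi_tv\|$; $z$ is regular if this limsup is a limit. *)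

theory Defs
  imports "HOL-Analysis.Analysis"
begin

definition is_flow :: "(real \<Rightarrow> real^'n \<Rightarrow> real^'n) \<Rightarrow> bool" where
  "is_flow \<Phi> \<longleftrightarrow> (\<forall>x. \<Phi> 0 x = x) \<and> (\<forall>s t x. \<Phi> (s + t) x = \<Phi> s (\<Phi> t x))
     \<and> continuous_on UNIV (\<lambda>(t, x). \<Phi> t x)"

definition Dflow :: "(real \<Rightarrow> real^'n \<Rightarrow> real^'n) \<Rightarrow> real \<Rightarrow> real^'n \<Rightarrow> real^'n \<Rightarrow> real^'n" where
  "Dflow \<Phi> t x = frechet_derivative (\<Phi> t) (at x)"

definition C1alpha_flow :: "real \<Rightarrow> (real \<Rightarrow> real^'n \<Rightarrow> real^'n) \<Rightarrow> bool" where
  "C1alpha_flow \<alpha> \<Phi> \<longleftrightarrow> 0 < \<alpha> \<and> \<alpha> \<le> 1 \<and>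
     (\<exists>D :: real \<Rightarrow> real^'n \<Rightarrow> ((real^'n) \<Rightarrow>\<^sub>L (real^'n)).
        (\<forall>t x. (\<Phi> t has_derivative blinfun_apply (D t x)) (at x))
      \<and> continuous_on UNIV (\<lambda>(t, x). D t x)
      \<and> (\<forall>t K. compact K \<longrightarrow> (\<exists>L. \<forall>x\<in>K. \<forall>y\<in>K. norm (D t x - D t y) \<le> L * dist x y powr \<alpha>)))"

definition k_cone :: "nat \<Rightarrow> (real^'n) set \<Rightarrow> bool" where
  "k_cone k C \<longleftrightarrow> closed C \<and> (\<forall>v\<in>C. \<forall>l::real. l *\<^sub>R v \<in> C)
     \<and> (\<exists>W. subspace W \<and> W \<subseteq> C \<and> dim W = k)
     \<and> (\<forall>W. subspace W \<and> W \<subseteq> C \<longrightarrow> dim W \<le> k)"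

definition k_solid :: "nat \<Rightarrow> (real^'n) set \<Rightarrow> bool" where
  "k_solid k C \<longleftrightarrow> (\<exists>W. subspace W \<and> dim W = k \<and> W - {0} \<subseteq> interior C)"

definition strongly_monotone :: "(real^'n) set \<Rightarrow> (real \<Rightarrow> real^'n \<Rightarrow> real^'n) \<Rightarrow> bool" where
  "strongly_monotone C \<Phi> \<longleftrightarrow>
     (\<forall>x y t. x - y \<in> C \<and> t \<ge> 0 \<longrightarrow> \<Phi> t x - \<Phi> t y \<in> C)
   \<and> (\<forall>x y t. x \<noteq> y \<and> x - y \<in> C \<and> t > 0 \<longrightarrow> \<Phi> t x - \<Phi> t y \<in> interior C)"

definition FWW :: "real \<Rightarrow> nat \<Rightarrow> (real^'n) set \<Rightarrow> (real \<Rightarrow> real^'n \<Rightarrow> real^'n) \<Rightarrow> bool" where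
  "FWW \<alpha> k C \<Phi> \<longleftrightarrow> is_flow \<Phi> \<and> C1alpha_flow \<alpha> \<Phi> \<and> k_cone k C \<and> k_solid k C
     \<and> strongly_monotone C \<Phi>
     \<and> (\<forall>t x v. t > 0 \<and> v \<in> C - {0} \<longrightarrow> Dflow \<Phi> t x v \<in> interior C)"

definition forward_orbit :: "(real \<Rightarrow> real^'n \<Rightarrow> real^'n) \<Rightarrow> real^'n \<Rightarrow> (real^'n) set" where
  "forward_orbit \<Phi> x = (\<lambda>t. \<Phi> t x) ` {0..}"

definition omega_limit :: "(real \<Rightarrow> real^'n \<Rightarrow> real^'n) \<Rightarrow> real^'n \<Rightarrow> (real^'n) set" where
  "omega_limit \<Phi> x = {y. \<exists>s :: nat \<Rightarrow> real. filterlim s at_top sequentially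
                          \<and> (\<lambda>m. \<Phi> (s m) x) \<longlonglongrightarrow> y}"

definition omega_compact :: "(real \<Rightarrow> real^'n \<Rightarrow> real^'n) \<Rightarrow> (real^'n) set \<Rightarrow> bool" where
  "omega_compact \<Phi> D \<longleftrightarrow> (\<forall>x\<in>D. bounded (forward_orbit \<Phi> x))
     \<and> bounded (\<Union>x\<in>D. omega_limit \<Phi> x)"

text \<open>Nontrivial orbit = orbit of a non-equilibrium point.\<close>
definition pseudo_ordered :: "(real^'n) set \<Rightarrow> (real \<Rightarrow> real^'n \<Rightarrow> real^'n) \<Rightarrow> real^'n \<Rightarrow> bool" where
  "pseudo_ordered C \<Phi> x \<longleftrightarrow> (\<exists>t. \<Phi> t x \<noteq> x)
     \<and> (\<exists>t1 t2. t1 \<ge> 0 \<and> t2 \<ge> 0 \<and> \<Phi> t1 x \<noteq> \<Phi> t2 x \<and> \<Phi> t1 x - \<Phi> t2 x \<in> C)"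

definition Qset :: "(real^'n) set \<Rightarrow> (real \<Rightarrow> real^'n \<Rightarrow> real^'n) \<Rightarrow> (real^'n) set" where
  "Qset C \<Phi> = {x. pseudo_ordered C \<Phi> x}"

definition half_gap :: "(real^'n) set \<Rightarrow> (real^'n) set \<Rightarrow> real" where
  "half_gap U V = Sup (insert 0 ((\<lambda>u. infdist u V) ` {u\<in>U. norm u = 1}))"

definition gap :: "(real^'n) set \<Rightarrow> (real^'n) set \<Rightarrow> real" where
  "gap U V = max (half_gap U V) (half_gap V U)"

definition gap_continuous_on :: "(real^'n) set \<Rightarrow> (real^'n \<Rightarrow> (real^'n) set) \<Rightarrow> bool" where
  "gap_continuous_on K E \<longleftrightarrow>
     (\<forall>y\<in>K. \<forall>\<epsilon>>0. \<exists>\<delta>>0. \<forall>y'\<in>K. dist y' y < \<delta> \<longrightarrow> gap (E y') (E y) < \<epsilon>)"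

definition k_exp_separation ::
  "nat \<Rightarrow> (real^'n) set \<Rightarrow> (real \<Rightarrow> real^'n \<Rightarrow> real^'n) \<Rightarrow> (real^'n) set
     \<Rightarrow> (real^'n \<Rightarrow> (real^'n) set) \<Rightarrow> (real^'n \<Rightarrow> (real^'n) set) \<Rightarrow> bool" where
  "k_exp_separation k C \<Phi> K E F \<longleftrightarrow>
     (\<forall>y\<in>K. subspace (E y) \<and> dim (E y) = k \<and> subspace (F y) \<and> dim (F y) = CARD('n) - k
            \<and> E y + F y = UNIV \<and> E y \<inter> F y = {0}
            \<and> E y \<subseteq> interior C \<union> {0} \<and> F y \<inter> C = {0})
   \<and> gap_continuous_on K E \<and> gap_continuous_on K F
   \<and> (\<forall>y\<in>K. \<forall>t>0. Dflow \<Phi> t y ` E y = E (\<Phi> t y) \<and> Dflow \<Phi> t y ` F y \<subseteq> F (\<Phi> t y))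
   \<and> (\<exists>M \<gamma>. M > 0 \<and> 0 < \<gamma> \<and> \<gamma> < 1 \<and>
       (\<forall>y\<in>K. \<forall>t\<ge>0. \<forall>w\<in>F y. \<forall>v\<in>E y. norm w = 1 \<and> norm v = 1 \<longrightarrow>
          norm (Dflow \<Phi> t y w) \<le> M * \<gamma> powr t * norm (Dflow \<Phi> t y v)))"

definition lyap_fun :: "(real \<Rightarrow> real^'n \<Rightarrow> real^'n) \<Rightarrow> (real^'n \<Rightarrow> (real^'n) set) \<Rightarrow> real^'n \<Rightarrow> real \<Rightarrow> ereal" where
  "lyap_fun \<Phi> E z t = ereal ((1 / t) * ln (INF v\<in>{v\<in>E z. norm v = 1}. norm (Dflow \<Phi> t z v)))"

definition k_lyapunov :: "(real \<Rightarrow> real^'n \<Rightarrow> real^'n) \<Rightarrow> (real^'n \<Rightarrow> (real^'n) set) \<Rightarrow> real^'n \<Rightarrow> ereal" where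
  "k_lyapunov \<Phi> E z = Limsup at_top (lyap_fun \<Phi> E z)"

definition lyap_regular :: "(real \<Rightarrow> real^'n \<Rightarrow> real^'n) \<Rightarrow> (real^'n \<Rightarrow> (real^'n) set) \<Rightarrow> real^'n \<Rightarrow> bool" where
  "lyap_regular \<Phi> E z \<longleftrightarrow> (lyap_fun \<Phi> E z \<longlongrightarrow> k_lyapunov \<Phi> E z) at_top"

end

(* Suppose x is not in Q. By strong monotonicity no difference Phi_t(x) - y with y in omega(x) is a
   nonzero vector of C. Start at a = Phi_s(x) close to z and split
   d_n = Phi_n(a) - Phi_n(z) = e_n + f_n along E + F. As d_n stays out of C, f_n controls d_n, and
   f_{n+1} = D Phi_1 f_n + O(|f_n|^(1+alpha)). Regularity and lambda_kz <= 0 turn the exponential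
   separation into the nonuniform contraction |D Phi_n|F_{Phi_m(z)}| <= A rho^n sigma^m with
   sigma as close to 1 as needed, so the superlinear error is absorbed and d_n tends to 0. This
   holds for all s in an interval, so small time shifts of the orbit of x are asymptotic to each
   other; hence z is an equilibrium and the whole orbit converges to it. *)

theory Submission
  imports Defs
begin

text \<open>The obstacle is the E-direction: a nonpositive exponent bounds its weakest stretching
  only, so the linearised flow need not contract E. The E-part is therefore never iterated; at each
  time the failure of order bounds it by the F-part. For F, let a(t) be the least stretching of unit
  vectors of E_z by D Phi_t. The separation started at Phi_m(z) gives the factor gamma^n
  a(m+n)/a(m). This quotient needs an upper bound on a(m+n) and a lower bound on a(m), which is why
  the exponent must be a limit and not only a limsup. The two errors leave a loss exp(2 eps m),
  growing with the starting time m. A linear error could not be summed against it; an error of order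
  1 + alpha at time m brings the additional factor rho^(alpha m), and this beats the loss once eps
  is small compared with alpha |ln gamma|. All estimates use the time-one map, so conclusions hold
  along integer times and are carried to general times through fractional parts.\<close>

section \<open>Absorbing a superlinear error in a nonuniform contraction\<close>

text \<open>A discrete Gronwall argument: with the bound for earlier indices inserted, the m-th
  summand is a multiple of \<open>\<rho> ^ n * (\<sigma> * \<rho> powr \<alpha>) ^ m\<close>, so the
  sum is dominated by a geometric series. It carries \<open>u 0 powr (1 + \<alpha>)\<close>, hence
  is at most the linear term if \<open>u 0\<close> is small. The threshold depends on the constants
  only, not on \<open>u\<close>.\<close>

lemma small_perturbation_decay:
  fixes A L \<rho> \<sigma> \<alpha> :: real
  assumes \<rho>: "0 < \<rho>" and \<sigma>: "0 \<le> \<sigma>" and \<sigma>\<rho>: "\<sigma> * \<rho> powr \<alpha> < 1"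
    and A: "0 < A" and L: "0 \<le> L" and \<alpha>: "0 < \<alpha>"
  obtains \<delta> where "0 < \<delta>"
    "\<And>(u :: nat \<Rightarrow> real) n. (\<And>n. 0 \<le> u n) \<Longrightarrow> u 0 \<le> \<delta> \<Longrightarrow>
       (\<And>n. u n \<le> A * \<rho> ^ n * u 0
          + (\<Sum>m<n. A * \<rho> ^ (n - Suc m) * \<sigma> ^ Suc m * (L * u m powr (1 + \<alpha>)))) \<Longrightarrow>
       u n \<le> 2 * A * \<rho> ^ n * u 0"
proof -
  define q where "q = \<sigma> * \<rho> powr \<alpha>"
  have q: "0 \<le> q" "q < 1" using assms by (auto simp: q_def)
  \<comment> \<open>Chosen so that the full geometric series of inserted errors equals
    \<open>A * \<rho> ^ n * (H * u 0 powr \<alpha> * u 0)\<close>.\<close>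
  define H where "H = \<sigma> * L / \<rho> / (1 - q) * (2 * A) powr (1 + \<alpha>)"
  have H: "0 \<le> H" using q assms by (simp add: H_def)
  \<comment> \<open>Makes \<open>H * \<delta> powr \<alpha>\<close> at most 1; the summand 1 covers
    the case \<open>H = 0\<close>.\<close>
  define \<delta> where "\<delta> = (1 / (H + 1)) powr (1 / \<alpha>)"
  have \<delta>: "0 < \<delta>" using H by (simp add: \<delta>_def)
  have \<delta>\<alpha>: "\<delta> powr \<alpha> = 1 / (H + 1)" using H \<alpha> by (simp add: \<delta>_def powr_powr)
  show thesis
  proof (rule that[OF \<delta>])
    fix u :: "nat \<Rightarrow> real" and n
    assume u0: "\<And>n. 0 \<le> u n" and small: "u 0 \<le> \<delta>"
      and step: "\<And>n. u n \<le> A * \<rho> ^ n * u 0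
          + (\<Sum>m<n. A * \<rho> ^ (n - Suc m) * \<sigma> ^ Suc m * (L * u m powr (1 + \<alpha>)))"
    have "u 0 powr \<alpha> \<le> \<delta> powr \<alpha>" using u0 small \<alpha> by (intro powr_mono2) auto
    then have "H * u 0 powr \<alpha> \<le> H * (1 / (H + 1))" using H \<delta>\<alpha> by (intro mult_left_mono) auto
    also have "\<dots> \<le> 1" using H by (simp add: divide_simps)
    finally have Hu: "H * u 0 powr \<alpha> \<le> 1" .
    have Hu0: "H * u 0 powr \<alpha> * u 0 \<le> u 0" using mult_right_mono[OF Hu u0[of 0]] by simp
    show "u n \<le> 2 * A * \<rho> ^ n * u 0"
    proof (induction n rule: less_induct)
      case (less n)
      have term_le: "A * \<rho> ^ (n - Suc m) * \<sigma> ^ Suc m * (L * u m powr (1 + \<alpha>))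
          \<le> A * \<rho> ^ n * (\<sigma> * L / \<rho> * (2 * A * u 0) powr (1 + \<alpha>)) * q ^ m" if "m < n" for m
      proof -
        have "u m powr (1 + \<alpha>) \<le> (2 * A * \<rho> ^ m * u 0) powr (1 + \<alpha>)"
          using less[OF that] u0 \<alpha> by (intro powr_mono2) auto
        also have "\<dots> = (2 * A * u 0) powr (1 + \<alpha>) * (\<rho> ^ m) powr (1 + \<alpha>)"
          using A \<rho> u0[of 0] by (simp add: powr_mult mult_ac)
        also have "(\<rho> ^ m) powr (1 + \<alpha>) = \<rho> ^ m * (\<rho> powr \<alpha>) ^ m"
        proof -
          have "(\<rho> ^ m) powr \<alpha> = (\<rho> powr \<alpha>) ^ m"
            using \<rho> by (simp add: powr_powr mult.commute flip: powr_realpow)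
          then show ?thesis using \<rho> by (simp add: powr_add)
        qed
        finally have um: "u m powr (1 + \<alpha>)
            \<le> (2 * A * u 0) powr (1 + \<alpha>) * (\<rho> ^ m * (\<rho> powr \<alpha>) ^ m)" .
        have pw: "\<rho> ^ (n - Suc m) * \<rho> ^ m = \<rho> ^ n / \<rho>"
        proof -
          have "\<rho> ^ (n - Suc m) * \<rho> ^ m * \<rho> = \<rho> ^ n"
            using that by (simp flip: power_add power_Suc2)
          then show ?thesis using \<rho> by (simp add: field_simps)
        qed
        have "A * \<rho> ^ (n - Suc m) * \<sigma> ^ Suc m * (L * u m powr (1 + \<alpha>))
            \<le> A * \<rho> ^ (n - Suc m) * \<sigma> ^ Suc m *
               (L * ((2 * A * u 0) powr (1 + \<alpha>) * (\<rho> ^ m * (\<rho> powr \<alpha>) ^ m)))"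
          using um L A \<rho> \<sigma> by (intro mult_left_mono) auto
        also have "\<dots> = A * (\<rho> ^ (n - Suc m) * \<rho> ^ m) *
               (\<sigma> * L * (2 * A * u 0) powr (1 + \<alpha>)) * (\<sigma> ^ m * (\<rho> powr \<alpha>) ^ m)"
          by (simp add: mult_ac)
        also have "\<dots> = A * \<rho> ^ n * (\<sigma> * L / \<rho> * (2 * A * u 0) powr (1 + \<alpha>)) * q ^ m"
          unfolding pw by (simp add: q_def power_mult_distrib)
        finally show ?thesis .
      qed
      have "(\<Sum>m<n. A * \<rho> ^ (n - Suc m) * \<sigma> ^ Suc m * (L * u m powr (1 + \<alpha>)))
          \<le> (\<Sum>m<n. A * \<rho> ^ n * (\<sigma> * L / \<rho> * (2 * A * u 0) powr (1 + \<alpha>)) * q ^ m)"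
        by (intro sum_mono term_le) auto
      also have "\<dots> = A * \<rho> ^ n * (\<sigma> * L / \<rho> * (2 * A * u 0) powr (1 + \<alpha>)) * (\<Sum>m<n. q ^ m)"
        by (simp add: sum_distrib_left)
      also have "\<dots> \<le> A * \<rho> ^ n * (\<sigma> * L / \<rho> * (2 * A * u 0) powr (1 + \<alpha>)) * (1 / (1 - q))"
      proof (rule mult_left_mono)
        show "(\<Sum>m<n. q ^ m) \<le> 1 / (1 - q)"
          using q by (simp add: sum_gp_strict divide_right_mono)
      qed (use A \<rho> \<sigma> L in auto)
      also have "\<dots> = A * \<rho> ^ n * (H * u 0 powr \<alpha> * u 0)"
        using A u0[of 0] by (simp add: H_def powr_mult powr_add mult_ac)
      also have "\<dots> \<le> A * \<rho> ^ n * u 0"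
        using Hu0 A \<rho> by (intro mult_left_mono) auto
      finally show ?case using step[of n] by simp
    qed
  qed
qed

section \<open>Uniform estimates for a gap-continuous splitting\<close>

lemma infdist_le_half_gap:
  assumes "0 \<in> V" "u \<in> U" "norm u = 1"
  shows "infdist u V \<le> half_gap U V"
proof -
  have "infdist w V \<le> 1" if "norm w = 1" for w
    using infdist_le[OF assms(1), of w] that by simp
  then have "bdd_above (insert 0 ((\<lambda>u. infdist u V) ` {u\<in>U. norm u = 1}))"
    by (intro bdd_aboveI[where M = 1]) auto
  then show ?thesis unfolding half_gap_def using assms by (intro cSup_upper) auto
qed

lemma infdist_le_gap:
  fixes v :: "real^'n"
  assumes U: "subspace U" and V: "subspace V" and v: "v \<in> U"
  shows "infdist v V \<le> norm v * gap U V"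
proof (cases "v = 0")
  case True
  then show ?thesis using subspace_0[OF V] by simp
next
  case False
  define u where "u = (1 / norm v) *\<^sub>R v"
  have u: "u \<in> U" "norm u = 1" "v = norm v *\<^sub>R u"
    using False v U by (auto simp: u_def subspace_scale)
  obtain w where w: "w \<in> V" "infdist u V = dist u w"
    using infdist_attains_inf[OF closed_subspace[OF V]] subspace_0[OF V] by blast
  have "infdist v V \<le> dist v (norm v *\<^sub>R w)"
    using w V by (intro infdist_le) (auto simp: subspace_scale)
  also have "\<dots> = norm v * dist u w"
  proof -
    have "v - norm v *\<^sub>R w = norm v *\<^sub>R (u - w)" using u by (simp add: scaleR_diff_right)
    then show ?thesis by (simp add: dist_norm)
  qed
  also have "dist u w \<le> gap U V"
    using infdist_le_half_gap[of V u U] u w subspace_0[OF V] by (simp add: gap_def)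
  finally show ?thesis by (simp add: mult_left_mono)
qed

text \<open>The bundle over K is closed: the distance of \<open>v j\<close> to the limit fibre is at
  most a bounded norm times a gap that tends to 0. Continuity of the families enters the compactness
  arguments below only in this form.\<close>

lemma gap_continuous_limit:
  fixes E :: "real^'n \<Rightarrow> (real^'n) set"
  assumes cont: "gap_continuous_on K E" and sub: "\<And>y. y \<in> K \<Longrightarrow> subspace (E y)"
    and Y: "\<And>j. Y j \<in> K" "y \<in> K" "Y \<longlonglongrightarrow> y"
    and v: "\<And>j. v j \<in> E (Y j)" "v \<longlonglongrightarrow> w"
  shows "w \<in> E y"
proof -
  have "(\<lambda>j. infdist (v j) (E y)) \<longlonglongrightarrow> 0"
  proof (rule LIMSEQ_I)
    fix r :: real assume r: "0 < r"
    obtain B where B: "0 < B" "\<And>j. norm (v j) \<le> B"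
      using convergent_imp_Bseq[of v] v(2) by (auto simp: convergent_def Bseq_def)
    obtain \<delta> where \<delta>: "0 < \<delta>" "\<And>y'. y' \<in> K \<Longrightarrow> dist y' y < \<delta> \<Longrightarrow> gap (E y') (E y) < r / B"
      using cont[unfolded gap_continuous_on_def, rule_format, OF Y(2), of "r / B"] r B(1) by auto
    obtain N where N: "\<And>j. j \<ge> N \<Longrightarrow> dist (Y j) y < \<delta>"
      using Y(3) \<delta>(1) unfolding lim_sequentially by blast
    have "norm (infdist (v j) (E y) - 0) < r" if "j \<ge> N" for j
    proof (cases "v j = 0")
      case True
      then show ?thesis using r subspace_0[OF sub[OF Y(2)]] by simp
    next
      case False
      have "infdist (v j) (E y) \<le> norm (v j) * gap (E (Y j)) (E y)"
        using infdist_le_gap[OF sub[OF Y(1)] sub[OF Y(2)] v(1)] .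
      also have "\<dots> < norm (v j) * (r / B)"
        using \<delta>(2)[OF Y(1) N[OF that]] False by (intro mult_strict_left_mono) auto
      also have "\<dots> \<le> B * (r / B)" using B r by (intro mult_right_mono) auto
      finally show ?thesis using B r by (simp add: infdist_nonneg)
    qed
    then show "\<exists>N. \<forall>j\<ge>N. norm (infdist (v j) (E y) - 0) < r" by blast
  qed
  moreover have "(\<lambda>j. infdist (v j) (E y)) \<longlonglongrightarrow> infdist w (E y)"
    using v(2) by (intro tendsto_infdist)
  ultimately have "infdist w (E y) = 0" using LIMSEQ_unique by blast
  then show ?thesis
    using in_closed_iff_infdist_zero[OF closed_subspace[OF sub[OF Y(2)]]]
      subspace_0[OF sub[OF Y(2)]] by blast
qed

text \<open>The projections onto F along E are uniformly bounded. Otherwise counterexamples, scaled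
  to make the F-part a unit vector, have sums tending to 0, and a limit of the F-parts is a unit
  vector in both fibres.\<close>

lemma splitting_component_bound:
  fixes E F :: "real^'n \<Rightarrow> (real^'n) set"
  assumes K: "compact K" and cont: "gap_continuous_on K E" "gap_continuous_on K F"
    and sub: "\<And>y. y \<in> K \<Longrightarrow> subspace (E y)" "\<And>y. y \<in> K \<Longrightarrow> subspace (F y)"
    and triv: "\<And>y. y \<in> K \<Longrightarrow> E y \<inter> F y = {0}"
  obtains P where "0 < P"
    "\<And>y e f. y \<in> K \<Longrightarrow> e \<in> E y \<Longrightarrow> f \<in> F y \<Longrightarrow> norm f \<le> P * norm (e + f)"
proof (rule ccontr)
  assume "\<not> thesis"
  then have "\<exists>y e f. y \<in> K \<and> e \<in> E y \<and> f \<in> F y \<and> norm f > real (Suc j) * norm (e + f)" for j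
    using that[of "real (Suc j)"] by (meson not_le of_nat_0_less_iff zero_less_Suc)
  then obtain Y e f where H: "\<And>j. Y j \<in> K" "\<And>j. e j \<in> E (Y j)" "\<And>j. f j \<in> F (Y j)"
    "\<And>j. norm (f j) > real (Suc j) * norm (e j + f j)" by metis
  have pos: "norm (f j) > 0" for j
    using H(4)[of j] by (smt (verit) mult_nonneg_nonneg norm_ge_zero of_nat_0_le_iff)
  define e' f' where "e' j = (1 / norm (f j)) *\<^sub>R e j" and "f' j = (1 / norm (f j)) *\<^sub>R f j" for j
  have e': "e' j \<in> E (Y j)" and f': "f' j \<in> F (Y j)" "norm (f' j) = 1" for j
    using H sub pos[of j] by (auto simp: e'_def f'_def subspace_scale)
  have sum0: "(\<lambda>j. e' j + f' j) \<longlonglongrightarrow> 0"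
  proof (rule Lim_null_comparison[OF _ LIMSEQ_inverse_real_of_nat], rule always_eventually, rule allI)
    fix j
    have "e' j + f' j = (1 / norm (f j)) *\<^sub>R (e j + f j)"
      by (simp add: e'_def f'_def scaleR_add_right)
    then have "norm (e' j + f' j) = norm (e j + f j) / norm (f j)" by simp
    also have "\<dots> \<le> inverse (real (Suc j))"
      using H(4)[of j] pos[of j] by (simp add: field_simps)
    finally show "norm (e' j + f' j) \<le> inverse (real (Suc j))" .
  qed
  have "compact (K \<times> sphere (0 :: real^'n) 1)" using K by (intro compact_Times) auto
  then obtain r p where r: "strict_mono r" "p \<in> K \<times> sphere 0 1"
    "((\<lambda>j. (Y j, f' j)) \<circ> r) \<longlonglongrightarrow> p"
    unfolding compact_def using H(1) f'(2) by (metis (no_types, lifting) SigmaI mem_sphere_0)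
  obtain y g where p: "p = (y, g)" "y \<in> K" "norm g = 1" using r(2) by auto
  have Y: "(\<lambda>j. Y (r j)) \<longlonglongrightarrow> y" and g: "(\<lambda>j. f' (r j)) \<longlonglongrightarrow> g"
    using tendsto_fst[OF r(3)] tendsto_snd[OF r(3)] by (simp_all add: o_def p)
  have "(\<lambda>j. (e' (r j) + f' (r j)) - f' (r j)) \<longlonglongrightarrow> 0 - g"
    using LIMSEQ_subseq_LIMSEQ[OF sum0 r(1)] g by (intro tendsto_diff) (simp_all add: o_def)
  then have e_lim: "(\<lambda>j. e' (r j)) \<longlonglongrightarrow> - g" by simp
  have "- g \<in> E y" "g \<in> F y"
    using gap_continuous_limit[OF cont(1) sub(1) _ p(2) Y _ e_lim]
      gap_continuous_limit[OF cont(2) sub(2) _ p(2) Y _ g] H(1) e' f' by auto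
  then have "- g \<in> E y \<inter> F y" using subspace_neg[OF sub(2)[OF p(2)]] by auto
  then show False using triv[OF p(2)] p(3) by auto
qed

text \<open>If the E-part dominated, the direction of \<open>e + f\<close> would be close to a unit
  vector of E, which is interior to C; compactness of K makes this uniform. This turns absence of
  order into a linear bound on the E-part.\<close>

lemma splitting_cone_bound:
  fixes E F :: "real^'n \<Rightarrow> (real^'n) set"
  assumes K: "compact K" and cont: "gap_continuous_on K E"
    and sub: "\<And>y. y \<in> K \<Longrightarrow> subspace (E y)" "\<And>y. y \<in> K \<Longrightarrow> subspace (F y)"
    and triv: "\<And>y. y \<in> K \<Longrightarrow> E y \<inter> F y = {0}"
    and cone: "\<And>v l. v \<in> C \<Longrightarrow> l *\<^sub>R v \<in> C" and EC: "\<And>y. y \<in> K \<Longrightarrow> E y \<subseteq> interior C \<union> {0}"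
  obtains P where "0 < P"
    "\<And>y e f. y \<in> K \<Longrightarrow> e \<in> E y \<Longrightarrow> f \<in> F y \<Longrightarrow> e + f \<notin> C - {0} \<Longrightarrow> norm e \<le> P * norm f"
proof (rule ccontr)
  assume "\<not> thesis"
  then have "\<exists>y e f. y \<in> K \<and> e \<in> E y \<and> f \<in> F y \<and> e + f \<notin> C - {0} \<and>
      norm e > real (Suc j) * norm f" for j
    using that[of "real (Suc j)"] by (meson not_le of_nat_0_less_iff zero_less_Suc)
  then obtain Y e f where H: "\<And>j. Y j \<in> K" "\<And>j. e j \<in> E (Y j)" "\<And>j. f j \<in> F (Y j)"
    "\<And>j. e j + f j \<notin> C - {0}" "\<And>j. norm (e j) > real (Suc j) * norm (f j)" by metis
  have pos: "norm (e j) > 0" for j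
    using H(5)[of j] by (smt (verit) mult_nonneg_nonneg norm_ge_zero of_nat_0_le_iff)
  define e' f' where "e' j = (1 / norm (e j)) *\<^sub>R e j" and "f' j = (1 / norm (e j)) *\<^sub>R f j" for j
  have e': "e' j \<in> E (Y j)" "norm (e' j) = 1" and f': "f' j \<in> F (Y j)" for j
    using H sub pos[of j] by (auto simp: e'_def f'_def subspace_scale)
  \<comment> \<open>The excluded vector 0 does no harm: \<open>e j + f j = 0\<close> would put
    \<open>e j\<close> into both fibres, against \<open>pos\<close>.\<close>
  have notC: "e' j + f' j \<notin> C" for j
  proof
    assume "e' j + f' j \<in> C"
    then have "norm (e j) *\<^sub>R (e' j + f' j) \<in> C" by (rule cone)
    then have "e j + f j \<in> C" using pos[of j] by (simp add: e'_def f'_def scaleR_add_right)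
    then have "e j = - f j" using H(4)[of j] by (simp add: eq_neg_iff_add_eq_0)
    then have "e j \<in> E (Y j) \<inter> F (Y j)" using H(2,3)[of j] subspace_neg[OF sub(2)[OF H(1)]] by auto
    then show False using triv[OF H(1)] pos[of j] by auto
  qed
  have f0: "f' \<longlonglongrightarrow> 0"
  proof (rule Lim_null_comparison[OF _ LIMSEQ_inverse_real_of_nat], rule always_eventually, rule allI)
    fix j
    show "norm (f' j) \<le> inverse (real (Suc j))"
      using H(5)[of j] pos[of j] by (simp add: f'_def field_simps)
  qed
  have "compact (K \<times> sphere (0 :: real^'n) 1)" using K by (intro compact_Times) auto
  then obtain r p where r: "strict_mono r" "p \<in> K \<times> sphere 0 1"
    "((\<lambda>j. (Y j, e' j)) \<circ> r) \<longlonglongrightarrow> p"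
    unfolding compact_def using H(1) e'(2) by (metis (no_types, lifting) SigmaI mem_sphere_0)
  obtain y g where p: "p = (y, g)" "y \<in> K" "norm g = 1" using r(2) by auto
  have Y: "(\<lambda>j. Y (r j)) \<longlonglongrightarrow> y" and g: "(\<lambda>j. e' (r j)) \<longlonglongrightarrow> g"
    using tendsto_fst[OF r(3)] tendsto_snd[OF r(3)] by (simp_all add: o_def p)
  have "g \<in> E y" using gap_continuous_limit[OF cont sub(1) _ p(2) Y _ g] H(1) e' by auto
  then have "g \<in> interior C" using EC[OF p(2)] p(3) by auto
  moreover have "(\<lambda>j. e' (r j) + f' (r j)) \<longlonglongrightarrow> g + 0"
    using LIMSEQ_subseq_LIMSEQ[OF f0 r(1)] g by (intro tendsto_add) (simp_all add: o_def)
  ultimately have "\<forall>\<^sub>F j in sequentially. e' (r j) + f' (r j) \<in> interior C"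
    using topological_tendstoD open_interior by fastforce
  then obtain j where "e' (r j) + f' (r j) \<in> interior C"
    using eventually_happens[of _ sequentially] by auto
  then show False using notC interior_subset by blast
qed


section \<open>Growth quotients at a regular point and the Hoelder remainder\<close>

text \<open>With a finite limit \<mu>, \<open>ln (a n)\<close> differs from \<mu> n by at most
  \<open>c + \<epsilon> * n\<close>. In the quotient \<mu> m cancels, \<mu> n is nonpositive, and
  the errors at m + n and at m add up to 2 c + \<epsilon> n + 2 \<epsilon> m. The geometric lower
  bound on \<open>a\<close> keeps the logarithms meaningful and excludes a limit of minus
  infinity.\<close>

lemma regular_growth_ratio:
  fixes a :: "real \<Rightarrow> real"
  assumes lim: "((\<lambda>t. ereal (1 / t * ln (a t))) \<longlongrightarrow> l) at_top" and l: "l \<le> 0"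
    and a: "\<And>n :: nat. b ^ n \<le> a n" and b: "0 < b" and \<epsilon>: "0 < \<epsilon>"
  obtains c where "\<And>m n :: nat. a (real m + real n) \<le> exp c * exp \<epsilon> ^ n * exp (2 * \<epsilon>) ^ m * a m"
proof -
  have a_pos: "0 < a (real n)" for n using a[of n] b by (meson less_le_trans zero_less_power)
  have seq: "(\<lambda>n. ereal (1 / real n * ln (a (real n)))) \<longlonglongrightarrow> l"
    using filterlim_compose[OF lim filterlim_real_sequentially] .
  have "\<forall>\<^sub>F n in sequentially. ereal (ln b) \<le> ereal (1 / real n * ln (a (real n)))"
    using eventually_gt_at_top[of 0]
  proof eventually_elim
    case (elim n)
    have "real n * ln b = ln (b ^ n)" using b by (simp add: ln_realpow)
    also have "\<dots> \<le> ln (a n)" using a[of n] b a_pos[of n] by (subst ln_le_cancel_iff) auto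
    finally show ?case using elim by (simp add: field_simps)
  qed
  then have "ereal (ln b) \<le> l" using seq tendsto_lowerbound by fastforce
  then obtain \<mu> where \<mu>: "l = ereal \<mu>" "\<mu> \<le> 0" using l by (cases l) auto
  have "(\<lambda>n. 1 / real n * ln (a (real n))) \<longlonglongrightarrow> \<mu>" using seq by (simp add: \<mu>)
  then obtain N where N: "\<And>n. n \<ge> N \<Longrightarrow> \<bar>1 / real n * ln (a (real n)) - \<mu>\<bar> < \<epsilon>"
    using \<epsilon> unfolding lim_sequentially dist_real_def by blast
  \<comment> \<open>The sum of the finitely many deviations up to N, so that the bound holds for
    every n.\<close>
  define c where "c = (\<Sum>n\<le>N. \<bar>ln (a (real n)) - \<mu> * real n\<bar>)"
  have bound: "\<bar>ln (a (real n)) - \<mu> * real n\<bar> \<le> c + \<epsilon> * real n" for n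
  proof (cases "n \<le> N")
    case True
    then have "\<bar>ln (a (real n)) - \<mu> * real n\<bar> \<le> c" unfolding c_def by (intro member_le_sum) auto
    then show ?thesis using \<epsilon> by (simp add: add_increasing2)
  next
    case False
    then have n: "0 < real n" by simp
    have "ln (a (real n)) - \<mu> * real n = real n * (1 / real n * ln (a (real n)) - \<mu>)"
      using n by (simp add: field_simps)
    then have "\<bar>ln (a (real n)) - \<mu> * real n\<bar> = real n * \<bar>1 / real n * ln (a (real n)) - \<mu>\<bar>"
      by (simp add: abs_mult)
    also have "\<dots> \<le> real n * \<epsilon>" using N[of n] False by (intro mult_left_mono) auto
    moreover have "0 \<le> c" unfolding c_def by (intro sum_nonneg) auto
    ultimately show ?thesis by (simp add: mult.commute)
  qed
  show thesis
  proof (rule that[of "2 * c"])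
    fix m n :: nat
    have "ln (a (real m + real n)) \<le> \<mu> * real n + 2 * c + \<epsilon> * real n + 2 * \<epsilon> * real m + ln (a m)"
      using bound[of "m + n"] bound[of m] by (simp add: abs_le_iff algebra_simps)
    also have "\<dots> \<le> 2 * c + \<epsilon> * real n + 2 * \<epsilon> * real m + ln (a m)"
      using \<mu>(2) by (simp add: mult_nonpos_nonneg)
    finally have "exp (ln (a (real m + real n)))
        \<le> exp (2 * c + \<epsilon> * real n + 2 * \<epsilon> * real m + ln (a m))" by simp
    then show "a (real m + real n) \<le> exp (2 * c) * exp \<epsilon> ^ n * exp (2 * \<epsilon>) ^ m * a m"
      using a_pos[of m] a_pos[of "m + n"]
      by (simp add: exp_add mult.commute flip: exp_of_nat_mult)
  qed
qed

text \<open>The mean value inequality on the segment from z to y, where no point is farther from z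
  than y. The Hoelder condition supplies the exponent above 1 on which the absorption of errors
  rests.\<close>

lemma holder_derivative_remainder:
  fixes g :: "'a::real_normed_vector \<Rightarrow> 'b::real_normed_vector" and g' :: "'a \<Rightarrow> 'a \<Rightarrow>\<^sub>L 'b"
  assumes deriv: "\<And>x. (g has_derivative blinfun_apply (g' x)) (at x)"
    and S: "convex S" "y \<in> S" "z \<in> S" and L: "0 \<le> L" and \<alpha>: "0 \<le> \<alpha>"
    and holder: "\<And>x. x \<in> S \<Longrightarrow> norm (g' x - g' z) \<le> L * dist x z powr \<alpha>"
  shows "norm (g y - g z - g' z (y - z)) \<le> L * norm (y - z) powr (1 + \<alpha>)"
proof -
  let ?S = "closed_segment z y"
  have seg: "?S \<subseteq> S" using closed_segment_subset[OF S(3,2,1)] .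
  have "norm (g y - g z - g' z (y - z)) \<le> norm (y - z) * (L * norm (y - z) powr \<alpha>)"
  proof (rule differentiable_bound_linearization[where S = ?S and f' = "\<lambda>x. blinfun_apply (g' x)"])
    show "z + t *\<^sub>R (y - z) \<in> ?S" if "t \<in> {0..1}" for t
      using that unfolding closed_segment_def by (auto simp: algebra_simps intro!: exI[of _ t])
    show "(g has_derivative blinfun_apply (g' x)) (at x within ?S)" for x
      using deriv has_derivative_at_withinI by blast
    fix x assume x: "x \<in> ?S"
    have "onorm (blinfun_apply (g' x) - blinfun_apply (g' z)) = norm (g' x - g' z)"
      by (simp add: norm_blinfun.rep_eq minus_blinfun.rep_eq fun_diff_def)
    also have "\<dots> \<le> L * dist x z powr \<alpha>" using holder x seg by blast
    also have "\<dots> \<le> L * norm (y - z) powr \<alpha>"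
      using segment_bound1[OF x] L \<alpha> by (intro mult_left_mono powr_mono2) (auto simp: dist_norm)
    finally show "onorm (blinfun_apply (g' x) - blinfun_apply (g' z)) \<le> L * norm (y - z) powr \<alpha>" .
  qed auto
  also have "\<dots> = L * norm (y - z) powr (1 + \<alpha>)" by (simp add: powr_add mult_ac)
  finally show ?thesis .
qed

section \<open>The derivative cocycle and omega-limit sets\<close>

text \<open>\<open>D\<close> presents the derivative as a bounded linear operator, which gives
  access to operator norms; \<open>Dflow_eq\<close> identifies it with \<open>Dflow\<close>.\<close>

locale smooth_flow =
  fixes \<Phi> :: "real \<Rightarrow> real^'n \<Rightarrow> real^'n" and D :: "real \<Rightarrow> real^'n \<Rightarrow> (real^'n) \<Rightarrow>\<^sub>L (real^'n)"
  assumes flow: "is_flow \<Phi>"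
    and deriv: "\<And>t x. (\<Phi> t has_derivative blinfun_apply (D t x)) (at x)"
    and D_continuous: "continuous_on UNIV (\<lambda>(t, x). D t x)"
begin

lemma flow_zero [simp]: "\<Phi> 0 x = x"
  and flow_add: "\<Phi> (s + t) x = \<Phi> s (\<Phi> t x)"
  using flow unfolding is_flow_def by blast+

lemma flow_minus [simp]: "\<Phi> (- t) (\<Phi> t x) = x" "\<Phi> t (\<Phi> (- t) x) = x"
  by (simp_all flip: flow_add)

lemma flow_tendsto:
  assumes "(f \<longlongrightarrow> t) A" "(g \<longlongrightarrow> x) A"
  shows "((\<lambda>i. \<Phi> (f i) (g i)) \<longlongrightarrow> \<Phi> t x) A"
proof -
  have "continuous_on UNIV (\<lambda>(t, x). \<Phi> t x)" using flow by (simp add: is_flow_def)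
  then have "isCont (\<lambda>(t, x). \<Phi> t x) (t, x)" by (simp add: continuous_on_eq_continuous_at)
  from isCont_tendsto_compose[OF this tendsto_Pair[OF assms]] show ?thesis by simp
qed

lemma Dflow_eq: "Dflow \<Phi> t x = blinfun_apply (D t x)"
  unfolding Dflow_def using frechet_derivative_at[OF deriv] by simp

lemma D_zero [simp]: "D 0 x v = v"
proof -
  have "\<Phi> 0 = (\<lambda>x. x)" by auto
  then have "(\<Phi> 0 has_derivative (\<lambda>v. v)) (at x)" by simp
  then show ?thesis using has_derivative_unique[OF deriv] by metis
qed

lemma D_add: "D (s + t) x v = D s (\<Phi> t x) (D t x v)"
proof -
  have "((\<Phi> s \<circ> \<Phi> t) has_derivative (blinfun_apply (D s (\<Phi> t x)) \<circ> blinfun_apply (D t x))) (at x)"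
    by (rule diff_chain_at[OF deriv deriv])
  moreover have "\<Phi> s \<circ> \<Phi> t = \<Phi> (s + t)" by (auto simp: flow_add)
  ultimately show ?thesis using has_derivative_unique[OF deriv] by (metis comp_apply)
qed

lemma D_minus [simp]: "D (- t) (\<Phi> t x) (D t x v) = v"
  by (simp flip: D_add)

text \<open>The flow runs backwards, so \<open>D 1 y\<close> has the inverse
  \<open>D (- 1) (\<Phi> 1 y)\<close>, whose norm is bounded on K by continuity. Iterated, this
  bounds stretching from below geometrically.\<close>

lemma D_inverse_bound:
  assumes "compact K"
  obtains B where "0 < B" "\<And>y v. y \<in> K \<Longrightarrow> norm v \<le> B * norm (D 1 y v)"
proof -
  have "continuous_on K (\<Phi> 1)"
    by (intro continuous_at_imp_continuous_on ballI has_derivative_continuous[OF deriv])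
  then have "continuous_on K (\<lambda>y. (\<lambda>(t, x). D t x) (- 1, \<Phi> 1 y))"
    by (intro continuous_on_compose2[OF D_continuous] continuous_intros) auto
  then have "bounded ((\<lambda>y. D (- 1) (\<Phi> 1 y)) ` K)"
    using assms by (simp add: compact_continuous_image compact_imp_bounded)
  then obtain B where B: "0 < B" "\<And>y. y \<in> K \<Longrightarrow> norm (D (- 1) (\<Phi> 1 y)) \<le> B"
    unfolding bounded_pos by auto
  have "norm v \<le> B * norm (D 1 y v)" if "y \<in> K" for y v
  proof -
    have "norm v = norm (D (- 1) (\<Phi> 1 y) (D 1 y v))" by simp
    also have "\<dots> \<le> norm (D (- 1) (\<Phi> 1 y)) * norm (D 1 y v)" by (rule norm_blinfun)
    also have "\<dots> \<le> B * norm (D 1 y v)" using B(2)[OF that] by (intro mult_right_mono) auto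
    finally show ?thesis .
  qed
  then show thesis using that B(1) by blast
qed

lemma omega_invariant:
  assumes "y \<in> omega_limit \<Phi> x"
  shows "\<Phi> t y \<in> omega_limit \<Phi> x"
proof -
  obtain s :: "nat \<Rightarrow> real" where s: "filterlim s at_top sequentially" "(\<lambda>m. \<Phi> (s m) x) \<longlonglongrightarrow> y"
    using assms by (auto simp: omega_limit_def)
  have "filterlim (\<lambda>m. t + s m) at_top sequentially"
    using s(1) by (intro filterlim_tendsto_add_at_top[OF tendsto_const])
  moreover have "(\<lambda>m. \<Phi> (t + s m) x) \<longlonglongrightarrow> \<Phi> t y"
    unfolding flow_add by (intro flow_tendsto tendsto_const s)
  ultimately show ?thesis by (auto simp: omega_limit_def)
qed

lemma omega_subset_closure: "omega_limit \<Phi> x \<subseteq> closure (forward_orbit \<Phi> x)"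
proof
  fix y assume "y \<in> omega_limit \<Phi> x"
  then obtain s :: "nat \<Rightarrow> real" where s: "filterlim s at_top sequentially" "(\<lambda>m. \<Phi> (s m) x) \<longlonglongrightarrow> y"
    by (auto simp: omega_limit_def)
  have "\<forall>\<^sub>F m in sequentially. \<Phi> (s m) x \<in> closure (forward_orbit \<Phi> x)"
    using filterlim_at_top[THEN iffD1, OF s(1), rule_format, of 0]
    by eventually_elim (use closure_subset in \<open>force simp: forward_orbit_def\<close>)
  then show "y \<in> closure (forward_orbit \<Phi> x)"
    using Lim_in_closed_set[OF closed_closure _ _ s(2)] by simp
qed

lemma omega_closed: "closed (omega_limit \<Phi> x)"
  unfolding closed_sequential_limits
proof (intro allI impI, elim conjE)
  fix Y y assume Y: "\<forall>n. Y n \<in> omega_limit \<Phi> x" "Y \<longlonglongrightarrow> y"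
  have "\<exists>t \<ge> real j. norm (\<Phi> t x - Y j) \<le> inverse (real (Suc j))" for j
  proof -
    obtain s :: "nat \<Rightarrow> real" where s: "filterlim s at_top sequentially" "(\<lambda>m. \<Phi> (s m) x) \<longlonglongrightarrow> Y j"
      using Y(1) by (force simp: omega_limit_def)
    have "\<forall>\<^sub>F m in sequentially. dist (\<Phi> (s m) x) (Y j) < inverse (real (Suc j))"
      using tendstoD[OF s(2)] by simp
    moreover have "\<forall>\<^sub>F m in sequentially. real j \<le> s m"
      using s(1) by (simp add: filterlim_at_top)
    ultimately obtain m where "dist (\<Phi> (s m) x) (Y j) < inverse (real (Suc j))" "real j \<le> s m"
      using eventually_happens[OF eventually_conj] by fastforce
    then show ?thesis by (intro exI[of _ "s m"]) (auto simp: dist_norm)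
  qed
  then obtain t where t: "\<And>j. real j \<le> t j"
    "\<And>j. norm (\<Phi> (t j) x - Y j) \<le> inverse (real (Suc j))" by metis
  have "(\<lambda>j. \<Phi> (t j) x - Y j) \<longlonglongrightarrow> 0"
    using t(2) by (intro Lim_null_comparison[OF _ LIMSEQ_inverse_real_of_nat] always_eventually) auto
  from tendsto_add[OF this Y(2)] have "(\<lambda>j. \<Phi> (t j) x) \<longlonglongrightarrow> y" by simp
  moreover have "filterlim t at_top sequentially"
    using t(1) by (intro filterlim_at_top_mono[OF filterlim_real_sequentially]) auto
  ultimately show "y \<in> omega_limit \<Phi> x" by (auto simp: omega_limit_def)
qed

lemma omega_compact_set:
  assumes "bounded (forward_orbit \<Phi> x)"
  shows "compact (omega_limit \<Phi> x)"
  using bounded_subset[OF bounded_closure[OF assms] omega_subset_closure] omega_closed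
  by (simp add: compact_eq_bounded_closed)

text \<open>Write the times approaching y as an integer plus \<open>a\<close> plus a fractional
  part. The fractional parts subconverge to some \<theta>, and flowing back by them leaves integer
  times, at the cost of replacing y by another point of its orbit.\<close>

lemma omega_integer_times:
  assumes "y \<in> omega_limit \<Phi> x"
  obtains N :: "nat \<Rightarrow> nat" and \<theta> where "filterlim N at_top sequentially"
    "(\<lambda>j. \<Phi> (real (N j) + a) x) \<longlonglongrightarrow> \<Phi> (- \<theta>) y"
proof -
  obtain s :: "nat \<Rightarrow> real" where s: "filterlim s at_top sequentially" "(\<lambda>m. \<Phi> (s m) x) \<longlonglongrightarrow> y"
    using assms by (auto simp: omega_limit_def)
  have "\<forall>j. frac (s j - a) \<in> {0..1}" by (simp add: frac_lt_1 less_imp_le)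
  then obtain \<theta> r where r: "strict_mono r" "((\<lambda>j. frac (s j - a)) \<circ> r) \<longlonglongrightarrow> \<theta>"
    using compact_Icc[of 0 "1::real"] unfolding compact_def by metis
  define N where "N j = nat \<lfloor>s (r j) - a\<rfloor>" for j
  have sr: "filterlim (\<lambda>j. s (r j)) at_top sequentially"
    using filterlim_compose[OF s(1) filterlim_subseq[OF r(1)]] .
  have "filterlim (\<lambda>j. - a + s (r j)) at_top sequentially"
    by (intro filterlim_tendsto_add_at_top[OF tendsto_const] sr)
  then have "filterlim (\<lambda>j. s (r j) - a) at_top sequentially" by simp
  then have "filterlim N at_top sequentially"
    unfolding N_def
    by (intro filterlim_compose[OF filterlim_nat_sequentially]
        filterlim_compose[OF filterlim_floor_sequentially])
  moreover have "(\<lambda>j. \<Phi> (real (N j) + a) x) \<longlonglongrightarrow> \<Phi> (- \<theta>) y"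
  proof (rule Lim_transform_eventually)
    show "(\<lambda>j. \<Phi> (- frac (s (r j) - a)) (\<Phi> (s (r j)) x)) \<longlonglongrightarrow> \<Phi> (- \<theta>) y"
      using r(2) LIMSEQ_subseq_LIMSEQ[OF s(2) r(1)]
      by (intro flow_tendsto tendsto_minus) (simp_all add: o_def)
    have "\<forall>\<^sub>F j in sequentially. a \<le> s (r j)" using sr by (simp add: filterlim_at_top)
    then show "\<forall>\<^sub>F j in sequentially.
        \<Phi> (- frac (s (r j) - a)) (\<Phi> (s (r j)) x) = \<Phi> (real (N j) + a) x"
    proof eventually_elim
      case (elim j)
      then have "- frac (s (r j) - a) + s (r j) = real (N j) + a"
        by (simp add: N_def frac_def)
      then show ?case by (simp flip: flow_add)
    qed
  qed
  ultimately show thesis using that by blast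
qed

text \<open>Being outside C is not preserved under limits, so order with y is first pushed into the
  open set \<open>interior C\<close> by the time-one map. There it holds already for orbit points
  near \<open>\<Phi> 1 y\<close>.\<close>

lemma omega_unordered:
  assumes mono: "strongly_monotone C \<Phi>"
    and unord: "\<And>t1 t2. 0 \<le> t1 \<Longrightarrow> 0 \<le> t2 \<Longrightarrow> \<Phi> t1 x \<noteq> \<Phi> t2 x \<Longrightarrow> \<Phi> t1 x - \<Phi> t2 x \<notin> C"
    and y: "y \<in> omega_limit \<Phi> x" and t: "0 \<le> t"
  shows "\<Phi> t x - y \<notin> C - {0}"
proof
  assume "\<Phi> t x - y \<in> C - {0}"
  then have "\<Phi> 1 (\<Phi> t x) - \<Phi> 1 y \<in> interior C" and ne: "\<Phi> t x \<noteq> y"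
    using mono unfolding strongly_monotone_def by auto
  then have int: "\<Phi> (1 + t) x - \<Phi> 1 y \<in> interior C" by (simp add: flow_add)
  obtain s :: "nat \<Rightarrow> real" where s: "filterlim s at_top sequentially" "(\<lambda>m. \<Phi> (s m) x) \<longlonglongrightarrow> y"
    using y by (auto simp: omega_limit_def)
  have lim: "(\<lambda>m. \<Phi> (1 + s m) x) \<longlonglongrightarrow> \<Phi> 1 y"
    unfolding flow_add by (intro flow_tendsto tendsto_const s)
  have "(\<lambda>m. \<Phi> (1 + t) x - \<Phi> (1 + s m) x) \<longlonglongrightarrow> \<Phi> (1 + t) x - \<Phi> 1 y"
    by (intro tendsto_diff tendsto_const lim)
  then have "\<forall>\<^sub>F m in sequentially. \<Phi> (1 + t) x - \<Phi> (1 + s m) x \<in> interior C"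
    using topological_tendstoD[OF _ open_interior int] by blast
  moreover have "\<forall>\<^sub>F m in sequentially. 0 \<le> s m" using s(1) by (simp add: filterlim_at_top)
  \<comment> \<open>Ordered points of the orbit must coincide, so the sequence is eventually
    constant and its limit \<open>\<Phi> 1 y\<close> is the point
    \<open>\<Phi> (1 + t) x\<close>.\<close>
  ultimately have "\<forall>\<^sub>F m in sequentially. \<Phi> (1 + s m) x = \<Phi> (1 + t) x"
  proof eventually_elim
    case (elim m)
    then show ?case using unord[of "1 + t" "1 + s m"] t interior_subset by fastforce
  qed
  then have "\<Phi> 1 y = \<Phi> (1 + t) x"
    using tendsto_unique[OF _ lim tendsto_eventually] by simp
  then have "\<Phi> (- 1) (\<Phi> 1 y) = \<Phi> (- 1) (\<Phi> 1 (\<Phi> t x))" by (simp add: flow_add)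
  then show False using ne by simp
qed

lemma locally_stationary_imp_equilibrium:
  assumes "0 < \<eta>" and stat: "\<And>r. \<bar>r\<bar> < \<eta> \<Longrightarrow> \<Phi> r q = q"
  shows "\<Phi> t q = q"
proof -
  obtain n :: nat where n: "\<bar>t\<bar> / \<eta> < real n" using reals_Archimedean2 by blast
  then have n0: "0 < real n" using assms(1) by (smt (verit) divide_nonneg_pos)
  then have "\<bar>t / real n\<bar> < \<eta>" using n assms(1) by (simp add: field_simps)
  then have fixed: "\<Phi> (t / real n) q = q" by (rule stat)
  have "\<Phi> (real m * (t / real n)) q = q" for m
  proof (induction m)
    case (Suc m)
    have "real (Suc m) * (t / real n) = t / real n + real m * (t / real n)"
      by (simp add: algebra_simps add_divide_distrib)
    then show ?case by (simp only: flow_add Suc fixed)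
  qed simp
  from this[of n] show ?thesis using n0 by simp
qed

section \<open>Contraction along F and attraction to the regular orbit\<close>

text \<open>The separation at \<open>\<Phi> (real m) z\<close> is tested against images p of unit
  vectors of \<open>E z\<close>. Since p has norm at least \<open>a m\<close>, an infimum over these
  vectors gives the contraction factor M \<gamma>^n a(m+n)/a(m), to which the growth quotient
  applies.\<close>

lemma regular_F_growth:
  assumes k: "1 \<le> k" and sep: "k_exp_separation k C \<Phi> K E F"
    and K: "compact K" and inv: "\<And>y t. y \<in> K \<Longrightarrow> 0 \<le> t \<Longrightarrow> \<Phi> t y \<in> K" and z: "z \<in> K"
    and reg: "lyap_regular \<Phi> E z" and nonpos: "k_lyapunov \<Phi> E z \<le> 0" and \<alpha>: "0 < \<alpha>"
  obtains A \<rho> \<sigma> :: real where "0 < A" "0 < \<rho>" "\<rho> < 1" "0 \<le> \<sigma>" "\<sigma> * \<rho> powr \<alpha> < 1"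
    "\<And>(m :: nat) (n :: nat) w. w \<in> F (\<Phi> (real m) z) \<Longrightarrow>
       norm (D (real n) (\<Phi> (real m) z) w) \<le> A * \<rho> ^ n * \<sigma> ^ m * norm w"
proof -
  obtain M \<gamma> where M: "0 < M" "0 < \<gamma>" "\<gamma> < 1" and M_sep:
    "\<And>y t w v. y \<in> K \<Longrightarrow> 0 \<le> t \<Longrightarrow> w \<in> F y \<Longrightarrow> v \<in> E y \<Longrightarrow> norm w = 1 \<Longrightarrow> norm v = 1 \<Longrightarrow>
       norm (D t y w) \<le> M * \<gamma> powr t * norm (D t y v)"
    using sep[unfolded k_exp_separation_def Dflow_eq, THEN conjunct2, THEN conjunct2,
        THEN conjunct2, THEN conjunct2] by blast
  have sub: "subspace (E y)" "subspace (F y)" "dim (E y) = k" if "y \<in> K" for y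
    using sep[unfolded k_exp_separation_def, THEN conjunct1] that by blast+
  have E_inv: "D t y v \<in> E (\<Phi> t y)" if "y \<in> K" "0 \<le> t" "v \<in> E y" for t y v
  proof (cases "t = 0")
    case False
    then have "blinfun_apply (D t y) ` E y = E (\<Phi> t y)"
      using sep[unfolded k_exp_separation_def Dflow_eq, THEN conjunct2, THEN conjunct2,
          THEN conjunct2, THEN conjunct1] that by force
    then show ?thesis using that by blast
  qed (use that in simp)
  define S where "S = {v \<in> E z. norm v = 1}"
  \<comment> \<open>Here \<open>1 \<le> k\<close> enters: the infimum defining the exponent needs a
    nonempty set.\<close>
  have S_ne: "S \<noteq> {}"
  proof -
    have "\<not> E z \<subseteq> {0}" using sub(3)[OF z] k dim_eq_0[of "E z"] by auto
    then obtain v where v: "v \<in> E z" "v \<noteq> 0" by blast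
    then have "(1 / norm v) *\<^sub>R v \<in> S" using sub(1)[OF z] by (simp add: S_def subspace_scale)
    then show ?thesis by blast
  qed
  define a where "a t = (INF v\<in>S. norm (D t z v))" for t
  have a_le: "a t \<le> norm (D t z v)" if "v \<in> S" for t v
    unfolding a_def using that by (intro cINF_lower bdd_belowI2[where m = 0]) auto
  obtain B where B: "0 < B" "\<And>y v. y \<in> K \<Longrightarrow> norm v \<le> B * norm (D 1 y v)"
    using D_inverse_bound[OF K] by blast
  have expand: "norm v \<le> B ^ n * norm (D (real n) z v)" for v and n :: nat
  proof (induction n)
    case (Suc n)
    have "norm (D (real n) z v) \<le> B * norm (D 1 (\<Phi> (real n) z) (D (real n) z v))"
      using B(2)[OF inv[OF z]] by simp
    also have "D 1 (\<Phi> (real n) z) (D (real n) z v) = D (real (Suc n)) z v" by (simp flip: D_add)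
    finally have "B ^ n * norm (D (real n) z v) \<le> B ^ n * (B * norm (D (real (Suc n)) z v))"
      using B(1) by (intro mult_left_mono) auto
    then show ?case using Suc by (simp add: mult_ac)
  qed simp
  have a_ge: "(1 / B) ^ n \<le> a (real n)" for n :: nat
    unfolding a_def
  proof (rule cINF_greatest[OF S_ne])
    fix v assume "v \<in> S"
    then show "(1 / B) ^ n \<le> norm (D (real n) z v)"
      using expand[of v n] B(1) by (simp add: S_def power_divide field_simps)
  qed
  have a_pos: "0 < a (real n)" for n :: nat
    using a_ge[of n] B(1) by (meson less_le_trans zero_less_power zero_less_divide_1_iff)
  have "lyap_fun \<Phi> E z = (\<lambda>t. ereal (1 / t * ln (a t)))"
    by (simp add: fun_eq_iff lyap_fun_def a_def S_def Dflow_eq)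
  then have lim: "((\<lambda>t. ereal (1 / t * ln (a t))) \<longlongrightarrow> k_lyapunov \<Phi> E z) at_top"
    using reg by (simp add: lyap_regular_def)
  \<comment> \<open>the choice making \<open>exp (2 * \<epsilon>) * (\<gamma> * exp \<epsilon>) powr \<alpha> = \<gamma> powr (\<alpha> / 2)\<close>\<close>
  define \<epsilon> where "\<epsilon> = - \<alpha> * ln \<gamma> / (2 * (2 + \<alpha>))"
  have ln\<gamma>: "ln \<gamma> < 0" using M by simp
  have \<epsilon>: "0 < \<epsilon>" using ln\<gamma> \<alpha> by (simp add: \<epsilon>_def divide_neg_pos mult_pos_neg)
  obtain c where c: "\<And>m n :: nat. a (real m + real n) \<le> exp c * exp \<epsilon> ^ n * exp (2 * \<epsilon>) ^ m * a m"
    using regular_growth_ratio[OF lim nonpos a_ge _ \<epsilon>] B(1) by (metis zero_less_divide_1_iff)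
  \<comment> \<open>Each constant is a factor of the separation, M and \<gamma>, combined with one
    of the growth quotient.\<close>
  show thesis
  proof (rule that[of "M * exp c" "\<gamma> * exp \<epsilon>" "exp (2 * \<epsilon>)"])
    have \<epsilon>_eq: "2 * \<epsilon> * (2 + \<alpha>) = - \<alpha> * ln \<gamma>" using \<alpha> by (simp add: \<epsilon>_def field_simps)
    show "0 < M * exp c" "0 < \<gamma> * exp \<epsilon>" "0 \<le> exp (2 * \<epsilon>)" using M by auto
    have "exp (2 * \<epsilon>) * (\<gamma> * exp \<epsilon>) powr \<alpha> = exp (2 * \<epsilon> + \<alpha> * (ln \<gamma> + \<epsilon>))"
      using M by (simp add: powr_def ln_mult exp_add)
    also have "2 * \<epsilon> + \<alpha> * (ln \<gamma> + \<epsilon>) = \<alpha> * ln \<gamma> / 2"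
      using \<epsilon>_eq by (simp add: algebra_simps)
    also have "exp (\<alpha> * ln \<gamma> / 2) < 1" using \<alpha> ln\<gamma> by (simp add: mult_pos_neg)
    finally show "exp (2 * \<epsilon>) * (\<gamma> * exp \<epsilon>) powr \<alpha> < 1" .
    have "\<epsilon> < - ln \<gamma>"
    proof -
      have "\<epsilon> = - ln \<gamma> * (\<alpha> / (2 * (2 + \<alpha>)))" by (simp add: \<epsilon>_def)
      also have "\<dots> < - ln \<gamma> * 1" using ln\<gamma> \<alpha> by (intro mult_strict_left_mono) auto
      finally show ?thesis by simp
    qed
    then have "exp (ln \<gamma> + \<epsilon>) < 1" by simp
    then show "\<gamma> * exp \<epsilon> < 1" using M by (simp add: exp_add)
    fix m n :: nat and w
    assume w: "w \<in> F (\<Phi> (real m) z)"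
    let ?y = "\<Phi> (real m) z"
    have y: "?y \<in> K" using inv z by simp
    show "norm (D (real n) ?y w) \<le> M * exp c * (\<gamma> * exp \<epsilon>) ^ n * exp (2 * \<epsilon>) ^ m * norm w"
    proof (cases "w = 0")
      case False
      have \<gamma>n: "\<gamma> powr real n = \<gamma> ^ n" using M by (simp add: powr_realpow)
      \<comment> \<open>The norm of p is replaced by \<open>a m\<close> before the infimum is taken,
        so that v occurs on the right side only.\<close>
      have "norm (D (real n) ?y w) * a m / (M * \<gamma> ^ n * norm w) \<le> a (real m + real n)"
        unfolding a_def[of "real m + real n"]
      proof (rule cINF_greatest[OF S_ne])
        fix v assume v: "v \<in> S"
        define p where "p = D (real m) z v"
        have p: "p \<in> E ?y" using E_inv z v by (simp add: p_def S_def)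
        have ap: "a m \<le> norm p" using a_le[OF v] by (simp add: p_def)
        then have p0: "0 < norm p" using a_pos[of m] by linarith
        have "norm (D (real n) ?y ((1 / norm w) *\<^sub>R w)) \<le> M * \<gamma> powr n * norm (D (real n) ?y ((1 / norm p) *\<^sub>R p))"
          using M_sep[OF y, of n "(1 / norm w) *\<^sub>R w" "(1 / norm p) *\<^sub>R p"] w p False p0 sub[OF y]
          by (simp add: subspace_scale)
        then have "norm (D (real n) ?y w) * norm p \<le> M * \<gamma> ^ n * norm w * norm (D (real n) ?y p)"
          using False p0 by (simp add: blinfun.scaleR_right \<gamma>n field_simps)
        moreover have "D (real n) ?y p = D (real m + real n) z v"
          using D_add[of "real n" "real m"] by (simp add: p_def add.commute)
        moreover have "norm (D (real n) ?y w) * a m \<le> norm (D (real n) ?y w) * norm p"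
          using ap by (intro mult_left_mono) auto
        ultimately show "norm (D (real n) ?y w) * a m / (M * \<gamma> ^ n * norm w) \<le> norm (D (real m + real n) z v)"
          using M False by (simp add: field_simps)
      qed
      also have "\<dots> \<le> exp c * exp \<epsilon> ^ n * exp (2 * \<epsilon>) ^ m * a m" by (rule c)
      finally have "norm (D (real n) ?y w) / (M * \<gamma> ^ n * norm w) * a m
          \<le> exp c * exp \<epsilon> ^ n * exp (2 * \<epsilon>) ^ m * a m" by simp
      then have "norm (D (real n) ?y w) / (M * \<gamma> ^ n * norm w) \<le> exp c * exp \<epsilon> ^ n * exp (2 * \<epsilon>) ^ m"
        using a_pos[of m] by (simp only: mult_le_cancel_right_pos)
      then show ?thesis using M False
        by (simp add: pos_divide_le_eq power_mult_distrib mult_ac)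
    qed simp
  qed
qed

text \<open>Only F-components are propagated, by variation of constants along the orbit of z; the
  cone estimate recovers the full difference from them. The convex set S contains both orbits, so a
  single Hoelder constant serves all the segments between them.\<close>

lemma asymptotic_to_regular_orbit:
  assumes k: "1 \<le> k" and sep: "k_exp_separation k C \<Phi> K E F"
    and K: "compact K" and inv: "\<And>y t. y \<in> K \<Longrightarrow> 0 \<le> t \<Longrightarrow> \<Phi> t y \<in> K" and z: "z \<in> K"
    and reg: "lyap_regular \<Phi> E z" and nonpos: "k_lyapunov \<Phi> E z \<le> 0" and \<alpha>: "0 < \<alpha>"
    and cone: "\<And>v l. v \<in> C \<Longrightarrow> l *\<^sub>R v \<in> C"
    and S: "convex S" "K \<subseteq> S" and L: "0 \<le> L"
    and holder: "\<And>x y. x \<in> S \<Longrightarrow> y \<in> S \<Longrightarrow> norm (D 1 x - D 1 y) \<le> L * dist x y powr \<alpha>"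
  obtains \<delta> where "0 < \<delta>"
    "\<And>y. norm (y - z) < \<delta> \<Longrightarrow> (\<And>n :: nat. \<Phi> (real n) y \<in> S) \<Longrightarrow>
      (\<And>n :: nat. \<Phi> (real n) y - \<Phi> (real n) z \<notin> C - {0}) \<Longrightarrow>
      (\<lambda>n. \<Phi> (real n) y - \<Phi> (real n) z) \<longlonglongrightarrow> 0"
proof -
  have sub: "subspace (E y)" "subspace (F y)" "E y + F y = UNIV" "E y \<inter> F y = {0}"
    "E y \<subseteq> interior C \<union> {0}" if "y \<in> K" for y
    using sep[unfolded k_exp_separation_def, THEN conjunct1] that by blast+
  have gaps: "gap_continuous_on K E" "gap_continuous_on K F"
    using sep unfolding k_exp_separation_def by simp_all
  have step: "blinfun_apply (D 1 y) ` E y = E (\<Phi> 1 y)" "blinfun_apply (D 1 y) ` F y \<subseteq> F (\<Phi> 1 y)"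
    if "y \<in> K" for y
    using sep[unfolded k_exp_separation_def Dflow_eq, THEN conjunct2, THEN conjunct2,
        THEN conjunct2, THEN conjunct1, rule_format, OF that zero_less_one] by simp_all
  have D_E: "D 1 y v \<in> E (\<Phi> 1 y)" if "y \<in> K" "v \<in> E y" for y v
    using step(1)[OF that(1)] that(2) by blast
  have D_F: "D 1 y v \<in> F (\<Phi> 1 y)" if "y \<in> K" "v \<in> F y" for y v
    using step(2)[OF that(1)] that(2) by blast
  obtain P where P: "0 < P"
    "\<And>y e f. y \<in> K \<Longrightarrow> e \<in> E y \<Longrightarrow> f \<in> F y \<Longrightarrow> norm f \<le> P * norm (e + f)"
    using splitting_component_bound[OF K gaps sub(1,2,4)] by blast
  obtain Q where Q: "0 < Q" "\<And>y e f. y \<in> K \<Longrightarrow> e \<in> E y \<Longrightarrow> f \<in> F y \<Longrightarrow> e + f \<notin> C - {0} \<Longrightarrow>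
      norm e \<le> Q * norm f"
    using splitting_cone_bound[OF K gaps(1) sub(1,2,4) cone sub(5)] by blast
  obtain A \<rho> \<sigma> where A: "0 < A" "0 < \<rho>" "\<rho> < 1" "0 \<le> \<sigma>" "\<sigma> * \<rho> powr \<alpha> < 1" and growth:
    "\<And>(m :: nat) (n :: nat) w. w \<in> F (\<Phi> (real m) z) \<Longrightarrow>
       norm (D (real n) (\<Phi> (real m) z) w) \<le> A * \<rho> ^ n * \<sigma> ^ m * norm w"
    using regular_F_growth[OF k sep K inv z reg nonpos \<alpha>] by blast
  \<comment> \<open>P bounds the F-part of the remainder, L the remainder by a power of the
    difference, and 1 + Q the difference by its F-part.\<close>
  define H where "H = P * L * (1 + Q) powr (1 + \<alpha>)"
  have H: "0 \<le> H" using P(1) L by (simp add: H_def)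
  obtain \<delta> where \<delta>: "0 < \<delta>" and decay:
    "\<And>(u :: nat \<Rightarrow> real) n. (\<And>n. 0 \<le> u n) \<Longrightarrow> u 0 \<le> \<delta> \<Longrightarrow>
       (\<And>n. u n \<le> A * \<rho> ^ n * u 0
          + (\<Sum>m<n. A * \<rho> ^ (n - Suc m) * \<sigma> ^ Suc m * (H * u m powr (1 + \<alpha>)))) \<Longrightarrow>
       u n \<le> 2 * A * \<rho> ^ n * u 0"
    using small_perturbation_decay[OF A(2,4,5,1) H \<alpha>] by blast
  \<comment> \<open>Dividing by P is needed because the decay threshold concerns the F-part of y -
    z, which may exceed y - z by the factor P.\<close>
  show thesis
  proof (rule that[of "\<delta> / P"])
    show "0 < \<delta> / P" using \<delta> P by simp
    fix y assume near: "norm (y - z) < \<delta> / P" and yS: "\<And>n :: nat. \<Phi> (real n) y \<in> S"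
      and notC: "\<And>n :: nat. \<Phi> (real n) y - \<Phi> (real n) z \<notin> C - {0}"
    define \<zeta> where "\<zeta> n = \<Phi> (real n) z" for n
    define d where "d n = \<Phi> (real n) y - \<zeta> n" for n
    have \<zeta>: "\<zeta> n \<in> K" for n using inv z by (simp add: \<zeta>_def)
    have \<zeta>_Suc: "\<Phi> 1 (\<zeta> n) = \<zeta> (Suc n)" for n by (simp add: \<zeta>_def flip: flow_add)
    have split: "\<exists>e f. \<forall>n. e n \<in> E (Y n) \<and> f n \<in> F (Y n) \<and> v n = e n + f n"
      if "\<And>n. Y n \<in> K" for Y and v :: "nat \<Rightarrow> real^'n"
    proof -
      have "v n \<in> E (Y n) + F (Y n)" for n using sub(3)[OF that] by simp
      then have "\<forall>n. \<exists>e f. e \<in> E (Y n) \<and> f \<in> F (Y n) \<and> v n = e + f"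
        unfolding set_plus_def by blast
      then show ?thesis by metis
    qed
    have unique: "f = f'"
      if "p \<in> K" "e \<in> E p" "e' \<in> E p" "f \<in> F p" "f' \<in> F p" "e + f = e' + f'" for p e e' f f'
    proof -
      have "e - e' = f' - f" using that(6) by (simp add: algebra_simps)
      then have "f' - f \<in> E p \<inter> F p"
        using subspace_diff[OF sub(1)[OF that(1)] that(2,3)]
          subspace_diff[OF sub(2)[OF that(1)] that(5,4)] by simp
      then show ?thesis using sub(4)[OF that(1)] by simp
    qed
    obtain e f where ef: "\<And>n. e n \<in> E (\<zeta> n)" "\<And>n. f n \<in> F (\<zeta> n)" "\<And>n. d n = e n + f n"
      using split[of \<zeta> d] \<zeta> by blast
    define r where "r n = d (Suc n) - D 1 (\<zeta> n) (d n)" for n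
    obtain re rf where r: "\<And>n. re n \<in> E (\<zeta> (Suc n))" "\<And>n. rf n \<in> F (\<zeta> (Suc n))"
      "\<And>n. r n = re n + rf n"
      using split[of "\<lambda>n. \<zeta> (Suc n)" r] \<zeta> by blast
    \<comment> \<open>Invariance of both bundles keeps the components apart: the E-part of the
      remainder does not enter the recursion for f.\<close>
    have f_Suc: "f (Suc n) = D 1 (\<zeta> n) (f n) + rf n" for n
    proof (rule unique[OF \<zeta>[of "Suc n"] ef(1)])
      show "D 1 (\<zeta> n) (e n) + re n \<in> E (\<zeta> (Suc n))"
        using D_E[OF \<zeta> ef(1)] r(1) sub(1)[OF \<zeta>] by (metis \<zeta>_Suc subspace_add)
      show "D 1 (\<zeta> n) (f n) + rf n \<in> F (\<zeta> (Suc n))"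
        using D_F[OF \<zeta> ef(2)] r(2) sub(2)[OF \<zeta>] by (metis \<zeta>_Suc subspace_add)
      have "d (Suc n) = D 1 (\<zeta> n) (d n) + r n" by (simp add: r_def)
      then show "e (Suc n) + f (Suc n) = D 1 (\<zeta> n) (e n) + re n + (D 1 (\<zeta> n) (f n) + rf n)"
        by (simp add: ef(3) r(3) blinfun.add_right)
    qed (rule ef(2))
    have d_le: "norm (d n) \<le> (1 + Q) * norm (f n)" for n
    proof -
      have "norm (e n) \<le> Q * norm (f n)"
        using Q(2)[OF \<zeta> ef(1,2)] notC[of n] by (simp add: d_def \<zeta>_def flip: ef(3))
      then show ?thesis using norm_triangle_ineq[of "e n" "f n"] by (simp add: ef(3) algebra_simps)
    qed
    have rf_le: "norm (rf n) \<le> H * norm (f n) powr (1 + \<alpha>)" for n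
    proof -
      have "norm (rf n) \<le> P * norm (r n)" using P(2)[OF \<zeta> r(1,2)] by (simp add: r(3))
      also have "r n = \<Phi> 1 (\<Phi> (real n) y) - \<Phi> 1 (\<zeta> n) - D 1 (\<zeta> n) (\<Phi> (real n) y - \<zeta> n)"
        by (simp add: r_def d_def \<zeta>_Suc flip: flow_add)
      also have "norm \<dots> \<le> L * norm (\<Phi> (real n) y - \<zeta> n) powr (1 + \<alpha>)"
        using holder \<zeta>[of n] S yS L \<alpha> by (intro holder_derivative_remainder[OF deriv S(1)]) auto
      also have "norm (\<Phi> (real n) y - \<zeta> n) powr (1 + \<alpha>) \<le> ((1 + Q) * norm (f n)) powr (1 + \<alpha>)"
        using d_le[of n] \<alpha> by (intro powr_mono2) (auto simp: d_def)
      also have "\<dots> = (1 + Q) powr (1 + \<alpha>) * norm (f n) powr (1 + \<alpha>)"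
        using Q(1) by (simp add: powr_mult)
      finally show ?thesis using P(1) L by (simp add: H_def mult_left_mono mult.assoc)
    qed
    \<comment> \<open>The error made in step m lies in the fibre at time m + 1 and is transported
      for the remaining n - m - 1 steps; hence \<open>Suc m\<close> also in the exponent of
      \<sigma>.\<close>
    have variation: "f n = D (real n) (\<zeta> 0) (f 0)
        + (\<Sum>m<n. D (real (n - Suc m)) (\<zeta> (Suc m)) (rf m))" for n
    proof (induction n)
      case (Suc n)
      have step: "D 1 (\<zeta> n) (D (real (n - m)) (\<zeta> m) w) = D (real (Suc n - m)) (\<zeta> m) w"
        if "m \<le> n" for m w
      proof -
        have "\<Phi> (real (n - m)) (\<zeta> m) = \<zeta> n" using that by (simp add: \<zeta>_def flip: flow_add)
        moreover have "real (Suc n - m) = 1 + real (n - m)" using that by simp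
        ultimately show ?thesis by (simp only: D_add)
      qed
      have "f (Suc n) = D 1 (\<zeta> n) (D (real n) (\<zeta> 0) (f 0))
          + (\<Sum>m<n. D 1 (\<zeta> n) (D (real (n - Suc m)) (\<zeta> (Suc m)) (rf m))) + rf n"
        unfolding f_Suc by (subst Suc) (simp add: blinfun.add_right blinfun.sum_right)
      also have "D 1 (\<zeta> n) (D (real n) (\<zeta> 0) (f 0)) = D (real (Suc n)) (\<zeta> 0) (f 0)"
        using step[of 0 "f 0"] by simp
      also have "(\<Sum>m<n. D 1 (\<zeta> n) (D (real (n - Suc m)) (\<zeta> (Suc m)) (rf m)))
          = (\<Sum>m<n. D (real (Suc n - Suc m)) (\<zeta> (Suc m)) (rf m))"
        by (intro sum.cong step refl) auto
      finally show ?case by (simp add: add.assoc)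
    qed simp
    have f_le: "norm (f n) \<le> 2 * A * \<rho> ^ n * norm (f 0)" for n
    proof (rule decay[where u = "\<lambda>n. norm (f n)"])
      have "norm (f 0) \<le> P * norm (y - z)" using P(2)[OF \<zeta>[of 0] ef(1,2)]
        by (simp add: d_def \<zeta>_def flip: ef(3))
      also have "\<dots> \<le> P * (\<delta> / P)" using near P(1) by (intro mult_left_mono) auto
      finally show "norm (f 0) \<le> \<delta>" using P(1) by simp
      fix n
      have "norm (f n) \<le> norm (D (real n) (\<zeta> 0) (f 0))
          + (\<Sum>m<n. norm (D (real (n - Suc m)) (\<zeta> (Suc m)) (rf m)))"
        by (subst variation) (intro norm_triangle_le add_mono order_refl norm_sum)
      also have "\<dots> \<le> A * \<rho> ^ n * norm (f 0)
          + (\<Sum>m<n. A * \<rho> ^ (n - Suc m) * \<sigma> ^ Suc m * (H * norm (f m) powr (1 + \<alpha>)))"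
      proof (intro add_mono sum_mono)
        show "norm (D (real n) (\<zeta> 0) (f 0)) \<le> A * \<rho> ^ n * norm (f 0)"
          using growth[of "f 0" 0 n] ef(2)[of 0] by (simp add: \<zeta>_def)
        fix m
        have "norm (D (real (n - Suc m)) (\<zeta> (Suc m)) (rf m))
            \<le> A * \<rho> ^ (n - Suc m) * \<sigma> ^ Suc m * norm (rf m)"
          using growth[of "rf m" "Suc m" "n - Suc m"] r(2)[of m] unfolding \<zeta>_def by blast
        also have "\<dots> \<le> A * \<rho> ^ (n - Suc m) * \<sigma> ^ Suc m * (H * norm (f m) powr (1 + \<alpha>))"
          using A by (intro mult_left_mono rf_le) auto
        finally show "norm (D (real (n - Suc m)) (\<zeta> (Suc m)) (rf m))
            \<le> A * \<rho> ^ (n - Suc m) * \<sigma> ^ Suc m * (H * norm (f m) powr (1 + \<alpha>))" .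
      qed
      finally show "norm (f n) \<le> A * \<rho> ^ n * norm (f 0)
          + (\<Sum>m<n. A * \<rho> ^ (n - Suc m) * \<sigma> ^ Suc m * (H * norm (f m) powr (1 + \<alpha>)))" .
    qed simp
    have "d \<longlonglongrightarrow> 0"
    proof (rule Lim_null_comparison[OF always_eventually], rule allI)
      fix n
      have "(1 + Q) * norm (f n) \<le> (1 + Q) * (2 * A * \<rho> ^ n * norm (f 0))"
        using Q(1) f_le by (intro mult_left_mono) auto
      then show "norm (d n) \<le> (1 + Q) * (2 * A * norm (f 0)) * \<rho> ^ n"
        using d_le[of n] by (simp add: mult_ac)
      show "(\<lambda>n. (1 + Q) * (2 * A * norm (f 0)) * \<rho> ^ n) \<longlonglongrightarrow> 0"
        using A by (intro tendsto_mult_right_zero LIMSEQ_realpow_zero) auto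
    qed
    then show "(\<lambda>n. \<Phi> (real n) y - \<Phi> (real n) z) \<longlonglongrightarrow> 0" by (simp add: d_def[abs_def] \<zeta>_def)
  qed
qed

section \<open>From asymptotic time shifts to convergence\<close>

text \<open>Subtracting the cases r and 0 eliminates the orbit of z. Along integer times at which
  the orbit of x approaches a point q of the orbit of z, this yields \<open>\<Phi> r q = q\<close>
  for all small r, so q and with it z is an equilibrium.\<close>

lemma omega_singleton_if_time_shifts_asymptotic:
  assumes z: "z \<in> omega_limit \<Phi> x" and \<eta>: "0 < \<eta>"
    and asym: "\<And>r. \<bar>r\<bar> < \<eta> \<Longrightarrow> (\<lambda>n. \<Phi> (real n) (\<Phi> (a + r) x) - \<Phi> (real n) z) \<longlonglongrightarrow> 0"
  shows "omega_limit \<Phi> x = {z}"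
proof -
  obtain N \<theta> where N: "filterlim N at_top sequentially"
    "(\<lambda>j. \<Phi> (real (N j) + a) x) \<longlonglongrightarrow> \<Phi> (- \<theta>) z"
    using omega_integer_times[OF z] by blast
  define q where "q = \<Phi> (- \<theta>) z"
  have "\<Phi> r q = q" if r: "\<bar>r\<bar> < \<eta>" for r
  proof -
    have "(\<lambda>n. (\<Phi> (real n) (\<Phi> (a + r) x) - \<Phi> (real n) z)
        - (\<Phi> (real n) (\<Phi> (a + 0) x) - \<Phi> (real n) z)) \<longlonglongrightarrow> 0 - 0"
      using r \<eta> by (intro tendsto_diff asym) auto
    then have "(\<lambda>n. \<Phi> (real n + (a + r)) x - \<Phi> (real n + a) x) \<longlonglongrightarrow> 0"
      by (simp add: flow_add)
    from filterlim_compose[OF this N(1)]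
    have "(\<lambda>j. (\<Phi> (real (N j) + (a + r)) x - \<Phi> (real (N j) + a) x)
        + \<Phi> (real (N j) + a) x) \<longlonglongrightarrow> 0 + q"
      unfolding q_def by (intro tendsto_add N(2))
    moreover have "(\<lambda>j. \<Phi> (real (N j) + (a + r)) x) = (\<lambda>j. \<Phi> r (\<Phi> (real (N j) + a) x))"
      by (simp add: add_ac flip: flow_add)
    moreover have "(\<lambda>j. \<Phi> r (\<Phi> (real (N j) + a) x)) \<longlonglongrightarrow> \<Phi> r q"
      unfolding q_def by (intro flow_tendsto tendsto_const N(2))
    ultimately show ?thesis using LIMSEQ_unique by auto
  qed
  then have q: "\<Phi> t q = q" for t using locally_stationary_imp_equilibrium[OF \<eta>] by blast
  have "z = \<Phi> \<theta> q" by (simp add: q_def)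
  then have fixed: "\<Phi> t z = z" for t using q by simp
  have "(\<lambda>n. (\<Phi> (real n) (\<Phi> (a + 0) x) - \<Phi> (real n) z) + z) \<longlonglongrightarrow> 0 + z"
    using \<eta> by (intro tendsto_add asym tendsto_const) auto
  then have lim: "(\<lambda>n. \<Phi> (real n + a) x) \<longlonglongrightarrow> z" by (simp add: fixed flow_add)
  have "y = z" if y: "y \<in> omega_limit \<Phi> x" for y
  proof -
    obtain N \<theta> where N: "filterlim N at_top sequentially"
      "(\<lambda>j. \<Phi> (real (N j) + a) x) \<longlonglongrightarrow> \<Phi> (- \<theta>) y"
      using omega_integer_times[OF y] by blast
    have "\<Phi> (- \<theta>) y = z" using LIMSEQ_unique[OF N(2) filterlim_compose[OF lim N(1)]] .
    then have "y = \<Phi> \<theta> z" by (metis flow_minus(2))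
    then show ?thesis by (simp add: fixed)
  qed
  then show ?thesis using z by blast
qed

end

section \<open>The dichotomy\<close>

theorem theorem4p2:
  fixes \<Phi> :: "real \<Rightarrow> real^'n \<Rightarrow> real^'n"
    and C :: "(real^'n) set" and k :: nat and \<alpha> :: real
    and \<D> :: "(real^'n) set" and x z :: "real^'n"
    and E F :: "real^'n \<Rightarrow> (real^'n) set"
  assumes "1 \<le> k"
    and "FWW \<alpha> k C \<Phi>"
    and "open \<D>" and "omega_compact \<Phi> \<D>" and "x \<in> \<D>"
    and "k_exp_separation k C \<Phi> (omega_limit \<Phi> x) E F"
    and "z \<in> omega_limit \<Phi> x" and "lyap_regular \<Phi> E z" and "k_lyapunov \<Phi> E z \<le> 0"
  shows "x \<in> Qset C \<Phi> \<or> omega_limit \<Phi> x = {z}"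
proof (rule disjCI)
  assume sing: "omega_limit \<Phi> x \<noteq> {z}"
  show "x \<in> Qset C \<Phi>"
  proof (rule ccontr)
    assume "x \<notin> Qset C \<Phi>"
    have flow: "is_flow \<Phi>" and smooth: "C1alpha_flow \<alpha> \<Phi>" and mono: "strongly_monotone C \<Phi>"
      and "k_cone k C"
      using assms(2) by (simp_all add: FWW_def)
    then have cone: "\<And>v l. v \<in> C \<Longrightarrow> l *\<^sub>R v \<in> C" by (simp add: k_cone_def)
    have \<alpha>: "0 < \<alpha>" using smooth by (simp add: C1alpha_flow_def)
    obtain D :: "real \<Rightarrow> real^'n \<Rightarrow> (real^'n) \<Rightarrow>\<^sub>L (real^'n)"
      where deriv: "\<And>t x. (\<Phi> t has_derivative blinfun_apply (D t x)) (at x)"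
        and D_cont: "continuous_on UNIV (\<lambda>(t, x). D t x)"
        and holder: "\<And>t K. compact K \<Longrightarrow>
          \<exists>L. \<forall>x\<in>K. \<forall>y\<in>K. norm (D t x - D t y) \<le> L * dist x y powr \<alpha>"
      using smooth unfolding C1alpha_flow_def by auto
    interpret smooth_flow \<Phi> D using flow deriv D_cont by unfold_locales
    \<comment> \<open>Pseudo-ordered orbits are nontrivial by definition, so equilibria are excluded
      first: their omega-limit set is a singleton.\<close>
    have not_equilibrium: "\<exists>t. \<Phi> t x \<noteq> x"
    proof (rule ccontr)
      assume "\<not> ?thesis"
      then have "forward_orbit \<Phi> x \<subseteq> {x}" by (auto simp: forward_orbit_def)
      then have "omega_limit \<Phi> x \<subseteq> {x}"
        using omega_subset_closure closure_minimal[of _ "{x}"] by blast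
      then show False using sing assms(7) by blast
    qed
    have unord: "\<Phi> t1 x - \<Phi> t2 x \<notin> C" if "0 \<le> t1" "0 \<le> t2" "\<Phi> t1 x \<noteq> \<Phi> t2 x" for t1 t2
      using \<open>x \<notin> Qset C \<Phi>\<close> not_equilibrium that by (auto simp: Qset_def pseudo_ordered_def)
    have bounded: "bounded (forward_orbit \<Phi> x)" using assms(4,5) by (simp add: omega_compact_def)
    \<comment> \<open>A ball is both compact, as the Hoelder bound requires, and convex, as the
      remainder estimate requires; it contains the forward orbit and its limit points.\<close>
    then obtain R where R: "closure (forward_orbit \<Phi> x) \<subseteq> cball 0 R"
      by (metis bounded_closure bounded_iff mem_cball_0 subsetI)
    obtain L' where L': "\<And>x y. x \<in> cball 0 R \<Longrightarrow> y \<in> cball 0 R \<Longrightarrow>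
        norm (D 1 x - D 1 y) \<le> L' * dist x y powr \<alpha>"
      using holder[OF compact_cball, of 0 R 1] by blast
    have L: "norm (D 1 x - D 1 y) \<le> \<bar>L'\<bar> * dist x y powr \<alpha>"
      if "x \<in> cball 0 R" "y \<in> cball 0 R" for x y
      using L'[OF that] mult_right_mono[OF abs_ge_self powr_ge_zero, of L' "dist x y" \<alpha>] by linarith
    obtain \<delta> where \<delta>: "0 < \<delta>" and attract:
      "\<And>y. norm (y - z) < \<delta> \<Longrightarrow> (\<And>n :: nat. \<Phi> (real n) y \<in> cball 0 R) \<Longrightarrow>
        (\<And>n :: nat. \<Phi> (real n) y - \<Phi> (real n) z \<notin> C - {0}) \<Longrightarrow>
        (\<lambda>n. \<Phi> (real n) y - \<Phi> (real n) z) \<longlonglongrightarrow> 0"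
      using asymptotic_to_regular_orbit[OF assms(1,6) omega_compact_set[OF bounded]
          omega_invariant assms(7-9) \<alpha> cone convex_cball
          subset_trans[OF omega_subset_closure R] abs_ge_zero L] by blast
    obtain s :: "nat \<Rightarrow> real" where s: "filterlim s at_top sequentially" "(\<lambda>m. \<Phi> (s m) x) \<longlonglongrightarrow> z"
      using assms(7) by (auto simp: omega_limit_def)
    have "\<forall>\<^sub>F m in sequentially. dist (\<Phi> (s m) x) z < \<delta>" using tendstoD[OF s(2) \<delta>] .
    \<comment> \<open>With a at least 1, shifts by less than 1 in either direction stay on the
      forward orbit.\<close>
    moreover have "\<forall>\<^sub>F m in sequentially. 1 \<le> s m" using s(1) by (simp add: filterlim_at_top)
    ultimately obtain a where a: "dist (\<Phi> a x) z < \<delta>" "1 \<le> a"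
      using eventually_happens[OF eventually_conj] by fastforce
    have "((\<lambda>r. \<Phi> (a + r) x) \<longlongrightarrow> \<Phi> (a + 0) x) (at 0)"
      by (intro flow_tendsto tendsto_intros)
    then have "((\<lambda>r. dist (\<Phi> (a + r) x) z) \<longlongrightarrow> dist (\<Phi> a x) z) (at 0)"
      by (intro tendsto_dist tendsto_const) simp
    then have "\<forall>\<^sub>F r in at 0. dist (\<Phi> (a + r) x) z < \<delta>" using order_tendstoD(2) a(1) by blast
    then obtain \<eta> where \<eta>: "0 < \<eta>"
      "\<And>r. r \<noteq> 0 \<Longrightarrow> \<bar>r\<bar> < \<eta> \<Longrightarrow> dist (\<Phi> (a + r) x) z < \<delta>"
      unfolding eventually_at by auto
    have "(\<lambda>n. \<Phi> (real n) (\<Phi> (a + r) x) - \<Phi> (real n) z) \<longlonglongrightarrow> 0" if r: "\<bar>r\<bar> < min \<eta> 1" for r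
    proof (rule attract)
      show "norm (\<Phi> (a + r) x - z) < \<delta>"
        using \<eta>(2)[of r] r a(1) by (cases "r = 0") (auto simp: dist_norm)
      fix n :: nat
      have time: "0 \<le> real n + (a + r)" using r a(2) by linarith
      then have "\<Phi> (real n + (a + r)) x \<in> forward_orbit \<Phi> x" by (simp add: forward_orbit_def)
      then show "\<Phi> (real n) (\<Phi> (a + r) x) \<in> cball 0 R"
        using R closure_subset unfolding flow_add by blast
      show "\<Phi> (real n) (\<Phi> (a + r) x) - \<Phi> (real n) z \<notin> C - {0}"
        using omega_unordered[OF mono unord omega_invariant[OF assms(7)] time] unfolding flow_add .
    qed
    then have "omega_limit \<Phi> x = {z}"
      using \<eta>(1) by (intro omega_singleton_if_time_shifts_asymptotic[OF assms(7), of "min \<eta> 1"]) auto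
    then show False using sing by contradiction
  qed
qed

end
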